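(* Let $n \ge 2$ be an integer, let $m_1,\dots,m_n$ and $\ell_1,\dots,\ell_n$ be positive real numbers, and let $d$ be a real number with $\max_{i} \ell_i < d < \sum_{i=1}^n \ell_i$. For $i \in \{1,\dots,n\}$ let $c_i = \frac12 m_i + \sum_{j=i+1}^n m_j$ (so $c_n = \frac12 m_n$). Consider the two optimization problems $$(P)\qquad \min_{y\in\mathbb{R}^n}\left\{ \sum_{i=1}^n c_i y_i \ :\ \sum_{i=1}^n y_i = 0,\ d - \sum_{i=1}^n \sqrt{\ell_i^2-y_i^2} = 0\right\}$$ and $$(C)\qquad \min_{y\in\mathbb{R}^n}\left\{ \sum_{i=1}^n c_i y_i \ :\ \sum_{i=1}^n y_i = 0,\ d - \sum_{i=1}^n \sqrt{\ell_i^2-y_i^2} \le 0\right\}.$$ Then: 1. problem $(C)$ is an instance of convex optimization; 2. the set of optimal solutions to $(C)$ is exactly the set of optimal solutions to $(P)$, and this set is a singleton.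
   Context: In both problems the square roots are real, so feasible vectors $y$ are implicitly required to satisfy $|y_i| \le \ell_i$ for every $i$. A minimization problem is an instance of convex optimization if its objective is a convex function, its equality constraints are linear (affine), and its inequality constraints have the form $g(y)\le 0$ with $g$ a convex function (here $g(y) = d - \sum_{i=1}^n \sqrt{\ell_i^2-y_i^2}$ on the convex set $\{y\in\mathbb{R}^n : |y_i|\le \ell_i \text{ for all } i\}$). An optimal solution is a feasible vector at which the minimum objective value over the feasible set is attained. (Interpretation: $m_i$, $\ell_i$ are the mass and length of link $i$ of a chain hanging from a horizontal beam at two points a distance $d$ apart, and $y_i$ is the vertical displacement of link $i$.) *)

theory Defs
  imports "HOL-Analysis.Analysis"
begin

(* The dom component is the set on which the constraint functions are meant to be
   evaluated, i.e. the implicit constraints of the problem. *)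
record 'v min_problem =
  dom :: "'v set"
  objective :: "'v \<Rightarrow> real"
  eq_constraints :: "('v \<Rightarrow> real) set"    (* h y = 0 *)
  ineq_constraints :: "('v \<Rightarrow> real) set"  (* g y \<le> 0 *)

definition feasible_set :: "'v min_problem \<Rightarrow> 'v set" where
  "feasible_set Q = {y \<in> dom Q. (\<forall>h \<in> eq_constraints Q. h y = 0) \<and>
                                (\<forall>g \<in> ineq_constraints Q. g y \<le> 0)}"

definition optimal_solutions :: "'v min_problem \<Rightarrow> 'v set" where
  "optimal_solutions Q =
     {y \<in> feasible_set Q. \<forall>z \<in> feasible_set Q. objective Q y \<le> objective Q z}"

definition affine_function :: "('v::real_vector \<Rightarrow> real) \<Rightarrow> bool" where
  "affine_function h \<longleftrightarrow> (\<exists>f b. linear f \<and> (\<forall>y. h y = f y + b))"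

(* convex_on S f includes the convexity of S; the first conjunct is stated for readability. *)
definition convex_optimization :: "('v::real_vector) min_problem \<Rightarrow> bool" where
  "convex_optimization Q \<longleftrightarrow>
     convex (dom Q) \<and> convex_on (dom Q) (objective Q) \<and>
     (\<forall>h \<in> eq_constraints Q. affine_function h) \<and>
     (\<forall>g \<in> ineq_constraints Q. convex_on (dom Q) g)"

(* The links 1, ..., n of the chain are indexed by an arbitrary finite linearly ordered
   type 'n with CARD('n) = n, so that {j. i < j} is the set of links i+1, ..., n. *)
definition link_coeff :: "real ^ 'n::{finite,linorder} \<Rightarrow> 'n::{finite,linorder} \<Rightarrow> real" where
  "link_coeff m i = m $ i / 2 + (\<Sum>j | i < j. m $ j)"

definition potential :: "real ^ 'n::{finite,linorder} \<Rightarrow> real ^ 'n::{finite,linorder} \<Rightarrow> real" where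
  "potential m y = (\<Sum>i\<in>UNIV. link_coeff m i * y $ i)"

definition span_defect :: "real ^ 'n \<Rightarrow> real \<Rightarrow> real ^ 'n \<Rightarrow> real" where
  "span_defect l d y = d - (\<Sum>i\<in>UNIV. sqrt ((l $ i)\<^sup>2 - (y $ i)\<^sup>2))"

(* The library's sqrt is total (sqrt (- x) = - sqrt x), so the requirement that the
   square roots be real has to be imposed explicitly through the domain. *)
definition link_box :: "real ^ 'n \<Rightarrow> (real ^ 'n) set" where
  "link_box l = {y. \<forall>i. \<bar>y $ i\<bar> \<le> l $ i}"

definition chain_problem_P ::
  "real ^ 'n::{finite,linorder} \<Rightarrow> real ^ 'n::{finite,linorder} \<Rightarrow> real \<Rightarrow> (real ^ 'n::{finite,linorder}) min_problem" where
  "chain_problem_P m l d =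
     \<lparr> dom = link_box l, objective = potential m,
       eq_constraints = {\<lambda>y. \<Sum>i\<in>UNIV. y $ i, span_defect l d},
       ineq_constraints = {} \<rparr>"

definition chain_problem_C ::
  "real ^ 'n::{finite,linorder} \<Rightarrow> real ^ 'n::{finite,linorder} \<Rightarrow> real \<Rightarrow> (real ^ 'n::{finite,linorder}) min_problem" where
  "chain_problem_C m l d =
     \<lparr> dom = link_box l, objective = potential m,
       eq_constraints = {\<lambda>y. \<Sum>i\<in>UNIV. y $ i},
       ineq_constraints = {span_defect l d} \<rparr>"

end

theory Submission
  imports Defs
begin

text \<open>
  The coefficients \<open>link_coeff m i\<close> strictly decrease in \<open>i\<close>. If the span constraint is slack at a
  feasible \<open>y\<close>, shifting a little vertical displacement from link \<open>i\<close> to a later link \<open>j\<close> lowers the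
  potential, unless \<open>y $ i = - l $ i\<close> or \<open>y $ j = l $ j\<close>. At an optimal \<open>y\<close> with slack, this blocking for all
  \<open>i < j\<close> would leave all links vertical except at most one, whose length is smaller than \<open>d\<close>.
  So the span constraint is tight at every optimum of \<open>(C)\<close>, which is therefore feasible for \<open>(P)\<close>.
  Existence is compactness. The span constraint is strictly convex, so it would be slack at the
  midpoint of two distinct optima.
\<close>

text \<open>The points of heights \<open>a\<close> and \<open>b\<close> on the half circle of radius
  \<open>r\<close> span a chord inside the disc, and the arc lies above it. The strict form is what
  later forces uniqueness.\<close>

lemma circle_concave:
  fixes a b r u v :: real
  assumes "\<bar>a\<bar> \<le> r" "\<bar>b\<bar> \<le> r" "u \<ge> 0" "v \<ge> 0" "u + v = 1"
  shows "u * sqrt (r\<^sup>2 - a\<^sup>2) + v * sqrt (r\<^sup>2 - b\<^sup>2) \<le> sqrt (r\<^sup>2 - (u * a + v * b)\<^sup>2)"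
    and "a \<noteq> b \<Longrightarrow> u > 0 \<Longrightarrow> v > 0 \<Longrightarrow>
      u * sqrt (r\<^sup>2 - a\<^sup>2) + v * sqrt (r\<^sup>2 - b\<^sup>2) < sqrt (r\<^sup>2 - (u * a + v * b)\<^sup>2)"
proof -
  define p q where "p = sqrt (r\<^sup>2 - a\<^sup>2)" and "q = sqrt (r\<^sup>2 - b\<^sup>2)"
  have "a\<^sup>2 \<le> r\<^sup>2" "b\<^sup>2 \<le> r\<^sup>2"
    using assms(1,2) by (metis abs_ge_zero power2_abs power_mono)+
  hence p: "p\<^sup>2 = r\<^sup>2 - a\<^sup>2" and q: "q\<^sup>2 = r\<^sup>2 - b\<^sup>2"
    by (simp_all add: p_def q_def)
  have v: "v = 1 - u" using assms(5) by simp
  \<comment> \<open>The vectors \<open>(a, p)\<close> and \<open>(b, q)\<close> both have norm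
    \<open>r\<close>; for \<open>u + v = 1\<close> this is the exact loss in squared norm of their
    convex combination.\<close>
  have id: "r\<^sup>2 - (u * a + v * b)\<^sup>2 - (u * p + v * q)\<^sup>2 = u * v * ((p - q)\<^sup>2 + (a - b)\<^sup>2)"
    using p q unfolding v by algebra
  have "u * v * ((p - q)\<^sup>2 + (a - b)\<^sup>2) \<ge> 0"
    using assms(3,4) by simp
  hence "(u * p + v * q)\<^sup>2 \<le> r\<^sup>2 - (u * a + v * b)\<^sup>2"
    using id by linarith
  thus "u * sqrt (r\<^sup>2 - a\<^sup>2) + v * sqrt (r\<^sup>2 - b\<^sup>2) \<le> sqrt (r\<^sup>2 - (u * a + v * b)\<^sup>2)"
    unfolding p_def[symmetric] q_def[symmetric] by (rule real_le_rsqrt)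
  assume "a \<noteq> b" "u > 0" "v > 0"
  hence "u * v * ((p - q)\<^sup>2 + (a - b)\<^sup>2) > 0"
    by (simp add: add_nonneg_pos)
  hence "(u * p + v * q)\<^sup>2 < r\<^sup>2 - (u * a + v * b)\<^sup>2"
    using id by linarith
  thus "u * sqrt (r\<^sup>2 - a\<^sup>2) + v * sqrt (r\<^sup>2 - b\<^sup>2) < sqrt (r\<^sup>2 - (u * a + v * b)\<^sup>2)"
    unfolding p_def[symmetric] q_def[symmetric] by (rule real_less_rsqrt)
qed

lemma convex_link_box: "convex (link_box l)" for l :: "real ^ 'n"
proof (rule convexI)
  fix x y :: "real ^ 'n" and u v :: real
  assume xy: "x \<in> link_box l" "y \<in> link_box l" and uv: "0 \<le> u" "0 \<le> v" "u + v = 1"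
  have "\<bar>u * x $ i + v * y $ i\<bar> \<le> l $ i" for i
  proof -
    have "x $ i \<in> {- (l $ i)..l $ i}" "y $ i \<in> {- (l $ i)..l $ i}"
      using xy by (auto simp: link_box_def abs_le_iff dest: spec[of _ i])
    hence "u *\<^sub>R x $ i + v *\<^sub>R y $ i \<in> {- (l $ i)..l $ i}"
      using uv by (intro convexD convex_real_interval)
    thus ?thesis by (simp add: abs_le_iff)
  qed
  thus "u *\<^sub>R x + v *\<^sub>R y \<in> link_box l" by (simp add: link_box_def)
qed

lemma compact_link_box: "compact (link_box l)"
proof -
  have "link_box l = cbox (- l) l"
    by (auto simp: link_box_def mem_box_cart abs_le_iff minus_le_iff)
  thus ?thesis by (metis compact_cbox)
qed

lemma convex_on_span_defect: "convex_on (link_box l) (span_defect l d)" for l :: "real ^ 'n"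
proof (rule convex_onI)
  fix t :: real and x y :: "real ^ 'n"
  assume t: "0 < t" "t < 1" and xy: "x \<in> link_box l" "y \<in> link_box l"
  have "(1 - t) * (\<Sum>i\<in>UNIV. sqrt ((l $ i)\<^sup>2 - (x $ i)\<^sup>2)) + t * (\<Sum>i\<in>UNIV. sqrt ((l $ i)\<^sup>2 - (y $ i)\<^sup>2))
      \<le> (\<Sum>i\<in>UNIV. sqrt ((l $ i)\<^sup>2 - ((1 - t) * x $ i + t * y $ i)\<^sup>2))"
    unfolding sum_distrib_left sum.distrib[symmetric]
    using t xy by (intro sum_mono circle_concave) (auto simp: link_box_def)
  thus "span_defect l d ((1 - t) *\<^sub>R x + t *\<^sub>R y)
      \<le> (1 - t) * span_defect l d x + t * span_defect l d y"
    by (simp add: span_defect_def algebra_simps)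
qed (rule convex_link_box)

text \<open>Distinct vectors differ in some coordinate; strict concavity there and weak concavity in
  all others make the whole sum strict.\<close>

lemma span_defect_midpoint_less:
  assumes "x \<in> link_box l" "y \<in> link_box l" "x \<noteq> y"
  shows "span_defect l d ((1/2) *\<^sub>R x + (1/2) *\<^sub>R y) < (span_defect l d x + span_defect l d y) / 2"
proof -
  obtain k where k: "x $ k \<noteq> y $ k" using assms(3) by (auto simp: vec_eq_iff)
  have "(\<Sum>i\<in>UNIV. 1/2 * sqrt ((l $ i)\<^sup>2 - (x $ i)\<^sup>2) + 1/2 * sqrt ((l $ i)\<^sup>2 - (y $ i)\<^sup>2))
      < (\<Sum>i\<in>UNIV. sqrt ((l $ i)\<^sup>2 - (1/2 * x $ i + 1/2 * y $ i)\<^sup>2))"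
  proof (rule sum_strict_mono_ex1)
    show "\<forall>i\<in>UNIV. 1/2 * sqrt ((l $ i)\<^sup>2 - (x $ i)\<^sup>2) + 1/2 * sqrt ((l $ i)\<^sup>2 - (y $ i)\<^sup>2)
        \<le> sqrt ((l $ i)\<^sup>2 - (1/2 * x $ i + 1/2 * y $ i)\<^sup>2)"
      using assms by (intro ballI circle_concave) (auto simp: link_box_def)
    have "1/2 * sqrt ((l $ k)\<^sup>2 - (x $ k)\<^sup>2) + 1/2 * sqrt ((l $ k)\<^sup>2 - (y $ k)\<^sup>2)
        < sqrt ((l $ k)\<^sup>2 - (1/2 * x $ k + 1/2 * y $ k)\<^sup>2)"
      using assms k by (intro circle_concave(2)) (auto simp: link_box_def)
    thus "\<exists>i\<in>UNIV. 1/2 * sqrt ((l $ i)\<^sup>2 - (x $ i)\<^sup>2) + 1/2 * sqrt ((l $ i)\<^sup>2 - (y $ i)\<^sup>2)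
        < sqrt ((l $ i)\<^sup>2 - (1/2 * x $ i + 1/2 * y $ i)\<^sup>2)" by blast
  qed simp
  thus ?thesis
    unfolding sum.distrib sum_distrib_left[symmetric] span_defect_def by (simp add: field_simps)
qed

text \<open>\<open>S\<close> is arbitrary because the total \<open>sqrt\<close> is continuous on the
  whole real line. Sublevel sets are thus closed in the full space, before intersecting with the
  box.\<close>

lemma continuous_on_span_defect: "continuous_on S (span_defect l d)"
  unfolding span_defect_def by (intro continuous_intros)

lemma linear_potential: "linear (potential m)"
  by (rule linearI) (simp_all add: potential_def algebra_simps sum.distrib sum_distrib_left)

lemma linear_sum_components: "linear (\<lambda>y :: real ^ 'n. \<Sum>i\<in>UNIV. y $ i)"
  by (rule linearI) (simp_all add: sum.distrib sum_distrib_left)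

lemma potential_axis: "potential m (axis i 1) = link_coeff m i"
  by (simp add: potential_def axis_def if_distrib[of "\<lambda>x. _ * x"] cong: if_cong)

text \<open>The mass of link \<open>j\<close> counts in full in the tail sum of \<open>i\<close> but
  only by half in the coefficient of \<open>j\<close>, so the gap is at least
  \<open>(m $ i + m $ j) / 2\<close>.\<close>

lemma link_coeff_strict_antimono:
  assumes "\<And>i. m $ i > 0" "i < j"
  shows "link_coeff m j < link_coeff m i"
proof -
  have "m $ j + (\<Sum>k | j < k. m $ k) = (\<Sum>k\<in>insert j {k. j < k}. m $ k)"
    by simp
  also have "\<dots> \<le> (\<Sum>k | i < k. m $ k)"
    using assms by (intro sum_mono2) (auto intro: less_imp_le)
  finally show ?thesis
    using assms(1)[of i] assms(1)[of j] by (simp add: link_coeff_def)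
qed

lemma feasible_set_C:
  "feasible_set (chain_problem_C m l d) =
     {y \<in> link_box l. (\<Sum>i\<in>UNIV. y $ i) = 0 \<and> span_defect l d y \<le> 0}"
  by (simp add: feasible_set_def chain_problem_C_def)

lemma feasible_set_P:
  "feasible_set (chain_problem_P m l d) =
     {y \<in> link_box l. (\<Sum>i\<in>UNIV. y $ i) = 0 \<and> span_defect l d y = 0}"
  by (simp add: feasible_set_def chain_problem_P_def)

lemma optimal_solutions_C:
  "optimal_solutions (chain_problem_C m l d) =
     {y \<in> feasible_set (chain_problem_C m l d).
        \<forall>z \<in> feasible_set (chain_problem_C m l d). potential m y \<le> potential m z}"
  by (simp add: optimal_solutions_def chain_problem_C_def)

lemma optimal_solutions_P:
  "optimal_solutions (chain_problem_P m l d) =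
     {y \<in> feasible_set (chain_problem_P m l d).
        \<forall>z \<in> feasible_set (chain_problem_P m l d). potential m y \<le> potential m z}"
  by (simp add: optimal_solutions_def chain_problem_P_def)

lemma convex_optimization_C: "convex_optimization (chain_problem_C m l d)"
proof -
  have "convex_on (link_box l) (potential m)"
    by (intro convex_onI convex_link_box)
      (simp add: linear_add[OF linear_potential] linear_scale[OF linear_potential])
  moreover have "affine_function (\<lambda>y :: real ^ 'a::{finite,linorder}. \<Sum>i\<in>UNIV. y $ i)"
    unfolding affine_function_def using linear_sum_components by (metis add.right_neutral)
  ultimately show ?thesis
    by (simp add: convex_optimization_def chain_problem_C_def convex_link_box convex_on_span_defect)
qed

lemma optimal_solutions_C_nonempty:
  assumes "\<And>i. l $ i > 0" "d < (\<Sum>i\<in>UNIV. l $ i)"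
  shows "optimal_solutions (chain_problem_C m l d) \<noteq> {}"
proof -
  let ?F = "feasible_set (chain_problem_C m l d)"
  have "closed {y :: real ^ 'a::{finite,linorder}. (\<Sum>i\<in>UNIV. y $ i) = 0}" "closed {y. span_defect l d y \<le> 0}"
    using continuous_on_span_defect by (intro closed_Collect_eq closed_Collect_le continuous_intros)+
  moreover have "?F = link_box l \<inter> ({y. (\<Sum>i\<in>UNIV. y $ i) = 0} \<inter> {y. span_defect l d y \<le> 0})"
    by (auto simp: feasible_set_C)
  ultimately have "compact ?F"
    by (metis closed_Int compact_Int_closed compact_link_box)
  \<comment> \<open>The zero vector is the chain stretched horizontally, whose span is the sum of
    all lengths and so exceeds \<open>d\<close>.\<close>
  moreover have "0 \<in> ?F"
    using assms by (simp add: feasible_set_C link_box_def span_defect_def less_imp_le)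
  moreover have "continuous_on ?F (potential m)"
    by (simp add: linear_continuous_on linear_potential linear_conv_bounded_linear[symmetric])
  ultimately show ?thesis
    unfolding optimal_solutions_C using continuous_attains_inf[of ?F "potential m"] by blast
qed

lemma slack_optimum_blocked:
  assumes opt: "y \<in> optimal_solutions (chain_problem_C m l d)"
    and slack: "span_defect l d y < 0" and m: "\<And>i. m $ i > 0" and "i < j"
  shows "y $ i = - l $ i \<or> y $ j = l $ j"
proof (rule ccontr)
  assume "\<not> ?thesis"
  moreover have y: "\<bar>y $ k\<bar> \<le> l $ k" for k
    using opt by (simp add: optimal_solutions_C feasible_set_C link_box_def)
  ultimately have ij: "- l $ i < y $ i" "y $ j < l $ j"
    using y[of i] y[of j] by linarith+
  \<comment> \<open>Displacement \<open>t\<close> moves from link \<open>i\<close> to link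
    \<open>j\<close>: the coordinate sum is preserved and the potential changes at rate
    \<open>link_coeff m j - link_coeff m i\<close>, which is negative.\<close>
  define w where "w t = y + t *\<^sub>R (axis j 1 - axis i 1)" for t :: real
  have "isCont (\<lambda>t. span_defect l d (w t)) 0"
    unfolding w_def span_defect_def by (intro continuous_intros)
  hence "((\<lambda>t. span_defect l d (w t)) \<longlongrightarrow> span_defect l d y) (at_right 0)"
    by (simp add: w_def continuous_at filterlim_at_split)
  hence "\<forall>\<^sub>F t in at_right 0. span_defect l d (w t) < 0"
    using slack by (rule order_tendstoD)
  \<comment> \<open>The two margins keep the lowered coordinate \<open>i\<close> and the raised
    coordinate \<open>j\<close> inside the box.\<close>
  moreover have "\<forall>\<^sub>F t in at_right 0. t \<in> {0<..<min (l $ i + y $ i) (l $ j - y $ j)}"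
    using ij by (intro eventually_at_right_real) simp
  ultimately have "\<forall>\<^sub>F t in at_right 0. span_defect l d (w t) < 0 \<and>
      t \<in> {0<..<min (l $ i + y $ i) (l $ j - y $ j)}"
    by (rule eventually_conj)
  then obtain t where t: "span_defect l d (w t) < 0" "0 < t" "t < l $ i + y $ i" "t < l $ j - y $ j"
    using eventually_happens'[OF trivial_limit_at_right_real] by force
  have "\<bar>w t $ k\<bar> \<le> l $ k" for k
    using y[of k] t \<open>i < j\<close> by (auto simp: w_def axis_def)
  moreover have "(\<Sum>k\<in>UNIV. w t $ k) = (\<Sum>k\<in>UNIV. y $ k)"
    by (simp add: w_def axis_def sum.distrib sum_subtractf flip: sum_distrib_left)
  ultimately have "w t \<in> feasible_set (chain_problem_C m l d)"
    using opt t(1) by (simp add: optimal_solutions_C feasible_set_C link_box_def)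
  hence "potential m y \<le> potential m (w t)"
    using opt by (simp add: optimal_solutions_C)
  also have "\<dots> = potential m y + t * (link_coeff m j - link_coeff m i)"
    by (simp add: w_def linear_add linear_scale linear_diff linear_potential potential_axis)
  also have "\<dots> < potential m y"
    using t(2) link_coeff_strict_antimono[OF m \<open>i < j\<close>] by (simp add: mult_pos_neg)
  finally show False by simp
qed

lemma optimal_solutions_C_tight:
  assumes opt: "y \<in> optimal_solutions (chain_problem_C m l d)"
    and m: "\<And>i. m $ i > 0" and l: "\<And>i. l $ i > 0" and d: "\<And>i. l $ i < d"
  shows "span_defect l d y = 0"
proof (rule ccontr)
  assume "span_defect l d y \<noteq> 0"
  with opt have slack: "span_defect l d y < 0"
    by (simp add: optimal_solutions_C feasible_set_C)
  note blocked = slack_optimum_blocked[OF opt slack m]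
  have sum0: "(\<Sum>i\<in>UNIV. y $ i) = 0"
    using opt by (simp add: optimal_solutions_C feasible_set_C)
  let ?A = "{i. y $ i \<noteq> - l $ i}"
  have "?A \<noteq> {}"
  proof
    assume "?A = {}"
    hence "(\<Sum>i\<in>UNIV. y $ i) = - (\<Sum>i\<in>UNIV. l $ i)" by (simp add: sum_negf)
    moreover have "(\<Sum>i\<in>UNIV. l $ i) > 0" by (intro sum_pos l) auto
    ultimately show False using sum0 by simp
  qed
  \<comment> \<open>Links before \<open>k\<close> sit at their lower bound by minimality; links
    after \<open>k\<close> sit at their upper bound by blocking against \<open>k\<close>. Only link
    \<open>k\<close> can contribute to the span.\<close>
  define k where "k = Min ?A"
  have k: "y $ k \<noteq> - l $ k" using Min_in[of ?A] \<open>?A \<noteq> {}\<close> by (simp add: k_def)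
  have "(l $ i)\<^sup>2 - (y $ i)\<^sup>2 = 0" if "i \<noteq> k" for i
  proof (cases "i < k")
    case True
    hence "i \<notin> ?A" unfolding k_def by (meson Min_le finite leD)
    thus ?thesis by simp
  next
    case False
    hence "y $ i = l $ i" using that k blocked[of k i] by auto
    thus ?thesis by simp
  qed
  hence "(\<Sum>i\<in>UNIV. sqrt ((l $ i)\<^sup>2 - (y $ i)\<^sup>2)) = sqrt ((l $ k)\<^sup>2 - (y $ k)\<^sup>2)"
    by (subst sum.remove[of _ k]) auto
  \<comment> \<open>The whole span is at most one link length, hence below \<open>d\<close>, whereas
    slack means a span above \<open>d\<close>.\<close>
  also have "\<dots> \<le> l $ k" using l[of k] by (intro real_le_lsqrt) auto
  finally show False using slack d[of k] by (simp add: span_defect_def)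
qed

lemma optimal_solutions_C_unique:
  assumes y: "y \<in> optimal_solutions (chain_problem_C m l d)"
    and z: "z \<in> optimal_solutions (chain_problem_C m l d)"
    and m: "\<And>i. m $ i > 0" and l: "\<And>i. l $ i > 0" and d: "\<And>i. l $ i < d"
  shows "y = z"
proof (rule ccontr)
  assume "y \<noteq> z"
  let ?w = "(1/2) *\<^sub>R y + (1/2) *\<^sub>R z"
  have yz: "y \<in> link_box l" "z \<in> link_box l" "(\<Sum>i\<in>UNIV. y $ i) = 0" "(\<Sum>i\<in>UNIV. z $ i) = 0"
    using y z by (auto simp: optimal_solutions_C feasible_set_C)
  have "span_defect l d ?w < (span_defect l d y + span_defect l d z) / 2"
    using yz \<open>y \<noteq> z\<close> by (intro span_defect_midpoint_less)
  \<comment> \<open>Both optima are tight, so the average of their defects is zero.\<close>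
  hence slack: "span_defect l d ?w < 0"
    using optimal_solutions_C_tight[OF _ m l d] y z by simp
  have "?w \<in> link_box l" using yz by (intro convexD[OF convex_link_box]) auto
  moreover have "(\<Sum>i\<in>UNIV. ?w $ i) = 0"
    using yz by (simp add: sum.distrib flip: sum_divide_distrib)
  ultimately have "?w \<in> feasible_set (chain_problem_C m l d)"
    using slack by (simp add: feasible_set_C)
  moreover have "potential m y = potential m z"
    using y z by (auto simp: optimal_solutions_C intro: antisym)
  \<comment> \<open>Linearity of the objective makes the midpoint optimal as well, so tightness
    applies to it and contradicts its slack.\<close>
  hence "potential m ?w = potential m y"
    by (simp add: linear_add linear_scale linear_potential)
  ultimately have "?w \<in> optimal_solutions (chain_problem_C m l d)"
    using y by (simp add: optimal_solutions_C)
  thus False using optimal_solutions_C_tight[OF _ m l d] slack by force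
qed

theorem theorem3:
  fixes m l :: "real ^ 'n::{finite,linorder}" and d :: real
  assumes "CARD('n) \<ge> 2"
    and "\<And>i. m $ i > 0"
    and "\<And>i. l $ i > 0"
    and "(MAX i. l $ i) < d"
    and "d < (\<Sum>i\<in>UNIV. l $ i)"
  shows "convex_optimization (chain_problem_C m l d) \<and>
    optimal_solutions (chain_problem_C m l d) = optimal_solutions (chain_problem_P m l d) \<and>
    is_singleton (optimal_solutions (chain_problem_C m l d))"
proof -
  let ?C = "chain_problem_C m l d" and ?P = "chain_problem_P m l d"
  have d: "l $ i < d" for i
    using assms(4) by simp
  obtain x where x: "x \<in> optimal_solutions ?C"
    using optimal_solutions_C_nonempty[OF assms(3,5)] by blast
  have C: "optimal_solutions ?C = {x}"
    using x optimal_solutions_C_unique[OF _ x assms(2,3) d] by blast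
  have PC: "feasible_set ?P \<subseteq> feasible_set ?C"
    by (auto simp: feasible_set_C feasible_set_P)
  have xP: "x \<in> feasible_set ?P"
    using x optimal_solutions_C_tight[OF x assms(2,3) d]
    by (simp add: optimal_solutions_C feasible_set_C feasible_set_P)
  have min: "potential m x \<le> potential m z" if "z \<in> feasible_set ?C" for z
    using x that by (simp add: optimal_solutions_C)
  have "optimal_solutions ?C \<subseteq> optimal_solutions ?P"
    unfolding C using xP PC min by (auto simp: optimal_solutions_P)
  \<comment> \<open>An optimum \<open>z\<close> of \<open>?P\<close> does at least as well as
    \<open>x\<close>, which is feasible for \<open>?P\<close>; since \<open>x\<close> attains the
    minimum over the larger feasible set of \<open>?C\<close>, so does \<open>z\<close>.\<close>
  moreover have "optimal_solutions ?P \<subseteq> optimal_solutions ?C"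
  proof
    fix z assume "z \<in> optimal_solutions ?P"
    hence "z \<in> feasible_set ?P" "potential m z \<le> potential m x"
      using xP by (simp_all add: optimal_solutions_P)
    thus "z \<in> optimal_solutions ?C"
      unfolding optimal_solutions_C using PC min order_trans by blast
  qed
  ultimately have "optimal_solutions ?C = optimal_solutions ?P"
    by (rule equalityI)
  thus ?thesis
    using C convex_optimization_C is_singletonI by metis
qed

end
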